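(* Let $z,\alpha\in\mathbb{R}$, $h>0$, and let $x_j=z+(\alpha+j)h$, $-r+1\le j\le r-1$, define a stencil of equally spaced nodes. Let $0\le i\le r-1$. If $f$ has a critical point of order $k$ at $z$, then the Jiang-Shu smoothness indicator $I_i$ satisfies $I_i=\bar{\mathcal O}(h^{2\kappa})$, where $$\kappa=\begin{cases}\min\{l\in\mathbb{N}:\ 2\mid l,\ l\ge k,\ f^{(l+1)}(z)\neq 0\} & \text{for } r=2 \text{ and } \alpha+i=1/2,\\ k+1 & \text{otherwise.}\end{cases}$$
   Context: Notation: $x_\lambda=z+(\alpha+\lambda)h$ also for half-integer $\lambda$. $\Pi_n$ is the space of real polynomials of degree at most $n$. Data: either point values $f_j=f(x_j)$, or cell averages $f_j=\frac1h\int_{x_{j-1/2}}^{x_{j+1/2}}f(x)\,dx$, for $-r+1\le j\le r-1$. Reconstruction polynomials: for $0\le i\le r-1$ and $S_{r,i}=\{x_{-r+1+i},\dots,x_i\}$ ($r$ points), $p_i\in\Pi_{r-1}$ is the polynomial with $p_i(x_j)=f_j$ for all $x_j\in S_{r,i}$ (point-value case), respectively $\frac1h\int_{x_{j-1/2}}^{x_{j+1/2}}p_i(x)\,dx=f_j$ for all $x_j\in S_{r,i}$ (cell-average case). Jiang-Shu smoothness indicator: $$I_i=\sum_{l=1}^{r-1}\int_{x_{-1/2}}^{x_{1/2}}h^{2l-1}\bigl(p_i^{(l)}(x)\bigr)^2\,dx .$$ A function $f$ has a critical point of order $k\ge 0$ at $z$ if $f^{(l)}(z)=0$ for $l=1,\dots,k$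 and $f^{(k+1)}(z)\ne 0$ (for $k=0$ this just means $f'(z)\neq 0$). $g(h)=\bar{\mathcal O}(h^{a})$ means $\limsup_{h\to0}|g(h)h^{-a}|<\infty$ and $\liminf_{h\to0}|g(h)h^{-a}|>0$.
   Formalization: For r=2 and α+i=1/2 the printed κ is false (f(x)=x, z=0 gives I_0=h²); here κ is that minimum plus 1, with its set assumed nonempty. Also r≥2 is assumed, and f is C^{k+1} near z (in the special case C^{l+1} for some l in the set). *)

theory Defs
  imports "HOL-Analysis.Analysis" "HOL-Computational_Algebra.Polynomial"
begin

definition node :: "real \<Rightarrow> real \<Rightarrow> real \<Rightarrow> real \<Rightarrow> real" where
  "node z \<alpha> h s = z + (\<alpha> + s) * h"

datatype data_kind = Point_Values | Cell_Averages

fun datum :: "data_kind \<Rightarrow> real \<Rightarrow> real \<Rightarrow> real \<Rightarrow> (real \<Rightarrow> real) \<Rightarrow> int \<Rightarrow> real" where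
  "datum Point_Values z \<alpha> h g j = g (node z \<alpha> h (of_int j))"
| "datum Cell_Averages z \<alpha> h g j =
     1 / h * integral {node z \<alpha> h (of_int j - 1/2) .. node z \<alpha> h (of_int j + 1/2)} g"

(* Applying datum to a polynomial expresses the interpolation conditions for both
   kinds of data. For h > 0 and r > 0 the conditions have exactly one solution. *)

definition recon_poly ::
    "data_kind \<Rightarrow> real \<Rightarrow> real \<Rightarrow> real \<Rightarrow> nat \<Rightarrow> nat \<Rightarrow> (real \<Rightarrow> real) \<Rightarrow> real poly" where
  "recon_poly d z \<alpha> h r i f =
     (THE p. degree p \<le> r - 1 \<and>
        (\<forall>j\<in>{- int r + 1 + int i .. int i}. datum d z \<alpha> h (poly p) j = datum d z \<alpha> h f j))"

definition smoothness_indicator ::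
    "data_kind \<Rightarrow> real \<Rightarrow> real \<Rightarrow> real \<Rightarrow> nat \<Rightarrow> nat \<Rightarrow> (real \<Rightarrow> real) \<Rightarrow> real" where
  "smoothness_indicator d z \<alpha> h r i f =
     (\<Sum>l = 1..r - 1. integral {node z \<alpha> h (- 1/2) .. node z \<alpha> h (1/2)}
        (\<lambda>x. h ^ (2 * l - 1) * (poly ((pderiv ^^ l) (recon_poly d z \<alpha> h r i f)) x)\<^sup>2))"

definition critical_point_of_order :: "(real \<Rightarrow> real) \<Rightarrow> nat \<Rightarrow> real \<Rightarrow> bool" where
  "critical_point_of_order f k z \<longleftrightarrow>
     (\<forall>l\<in>{1..k}. (deriv ^^ l) f z = 0) \<and> (deriv ^^ (k + 1)) f z \<noteq> 0"

(* f is of class C^n on a neighbourhood of z *)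

definition C_near :: "nat \<Rightarrow> (real \<Rightarrow> real) \<Rightarrow> real \<Rightarrow> bool" where
  "C_near n f z \<longleftrightarrow>
     (\<exists>\<epsilon>>0. (\<forall>m<n. \<forall>x\<in>ball z \<epsilon>. (deriv ^^ m) f field_differentiable at x) \<and>
            continuous_on (ball z \<epsilon>) ((deriv ^^ n) f))"

(* The exact order symbol O-bar(h^a) as h tends to 0 through positive values *)

definition exact_order :: "(real \<Rightarrow> real) \<Rightarrow> real \<Rightarrow> bool" where
  "exact_order g a \<longleftrightarrow>
     Limsup (at_right 0) (\<lambda>h. ereal \<bar>g h * h powr (- a)\<bar>) < \<infinity> \<and>
     Liminf (at_right 0) (\<lambda>h. ereal \<bar>g h * h powr (- a)\<bar>) > 0"

(* In the symmetric case r = 2, \<alpha> + i = 1/2 the difference of the two data only sees the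
   derivatives of odd order of f at z. If the first nonzero one is of order l + 1, then the
   difference is of exact order h^(l + 1) and the indicator of exact order h^(2 * (l + 1)).
   Hence the exponent is l + 1, in agreement with the generic value k + 1 when l = k; the
   source prints the minimum l itself, which already fails for f x = x, z = 0, \<alpha> = 1/2,
   i = 0, k = 0, where the indicator is h^2. *)

definition kappa :: "(real \<Rightarrow> real) \<Rightarrow> real \<Rightarrow> real \<Rightarrow> nat \<Rightarrow> nat \<Rightarrow> nat \<Rightarrow> nat" where
  "kappa f z \<alpha> r i k =
     (if r = 2 \<and> \<alpha> + real i = 1/2
      then (LEAST l. 2 dvd l \<and> l \<ge> k \<and> (deriv ^^ (l + 1)) f z \<noteq> 0) + 1
      else k + 1)"

end

(* In the variable t = (x - z) / h the nodes are alpha + j, and the smoothness indicator becomes a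
   quadratic form ("energy") in the data that ignores constants and is positive on every other
   polynomial. Write f (z + y) = e y + g y, where e gives the same datum at every node and
   g y ~ C y^N with C nonzero: generically e = f z and N = k + 1, and in the symmetric case
   r = 2, alpha + i = 1/2 the functions e and g are the even and odd parts. Then the indicator
   divided by h^(2 N) tends to C^2 times the energy of the reconstruction of t^N. This limit is
   nonzero unless all data of t^N on the stencil agree. As two adjacent data of t^N agree only if
   N is even and the two cells are symmetric about 0, this would force r = 2 and alpha + i = 1/2,
   where N is odd. *)
theory Submission
  imports Defs
begin

section \<open>Data as means over unit cells\<close>

text \<open>The datum in the scaled variable \<open>t = (x - z) / h\<close>: cells have length one,
  so the factor \<open>1 / h\<close> disappears. Once the elementary rules up to
  \<open>cell_mean_reflect\<close> are proved, the two kinds of data are treated alike.\<close>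

definition cell_mean :: "data_kind \<Rightarrow> real \<Rightarrow> (real \<Rightarrow> real) \<Rightarrow> real" where
  "cell_mean d c g =
     (case d of Point_Values \<Rightarrow> g c | Cell_Averages \<Rightarrow> integral {c - 1/2..c + 1/2} g)"

lemma integral_affine_Icc:
  fixes g :: "real \<Rightarrow> real"
  assumes "m > 0"
  shows "integral {c + a * m..c + b * m} g = m * integral {a..b} (\<lambda>t. g (c + t * m))"
proof -
  have "integral {c + a * m..c + b * m} g = integral {a * m..b * m} (g \<circ> (+) c)"
    by (simp add: integral_shift_Icc_real add.commute)
  also have "\<dots> = m * integral ((\<lambda>x. x / m) ` {a * m..b * m}) (\<lambda>t. (g \<circ> (+) c) (m * t))"
    using assms by (subst integral_stretch_real) auto
  also have "(\<lambda>x. x / m) ` {a * m..b * m} = {a..b}"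
    using assms by (simp add: image_divide_atLeastAtMost)
  finally show ?thesis
    by (simp add: o_def mult.commute)
qed

lemma datum_eq_cell_mean:
  assumes "h > 0"
  shows "datum d z \<alpha> h g j = cell_mean d (\<alpha> + of_int j) (\<lambda>t. g (z + t * h))"
proof (cases d)
  case Cell_Averages
  then show ?thesis
    using integral_affine_Icc[of h z "\<alpha> + of_int j - 1/2" "\<alpha> + of_int j + 1/2" g] assms
    by (simp add: cell_mean_def node_def add.assoc add_diff_eq)
qed (simp add: cell_mean_def node_def)

text \<open>For averages, the mean value theorem for the function \<open>x\<close> to
  \<open>integral {c - 1/2..x} g\<close>; for point values, \<open>\<xi>\<close> is the centre. The
  strict bounds matter later: open unit cells of different indices are disjoint.\<close>

lemma cell_mean_eq:
  assumes "continuous_on {c - 1/2..c + 1/2} g"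
  obtains \<xi> where "c - 1/2 < \<xi>" "\<xi> < c + 1/2" "cell_mean d c g = g \<xi>"
proof (cases d)
  case Cell_Averages
  have "((\<lambda>x. integral {c - 1/2..x} g) has_real_derivative g x) (at x within {c - 1/2..c + 1/2})"
    if "x \<in> {c - 1/2..c + 1/2}" for x
    using integral_has_real_derivative[OF assms that] .
  then have "((\<lambda>x. integral {c - 1/2..x} g) has_derivative (*) (g x)) (at x within {c - 1/2..c + 1/2})"
    if "c - 1/2 \<le> x" "x \<le> c + 1/2" for x
    using that by (auto simp: has_field_derivative_def)
  from mvt_simple[OF _ this]
  obtain \<xi> where "\<xi> \<in> {c - 1/2<..<c + 1/2}" "integral {c - 1/2..c + 1/2} g = g \<xi>"
    by auto
  with that Cell_Averages show ?thesis
    by (auto simp: cell_mean_def)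
qed (auto simp: cell_mean_def intro: that[of c])

lemma cell_mean_add:
  assumes "continuous_on {c - 1/2..c + 1/2} f" "continuous_on {c - 1/2..c + 1/2} g"
  shows "cell_mean d c (\<lambda>t. f t + g t) = cell_mean d c f + cell_mean d c g"
  using assms by (cases d) (auto simp: cell_mean_def integral_add integrable_continuous_real)

lemma cell_mean_cmult: "cell_mean d c (\<lambda>t. a * g t) = a * cell_mean d c g"
  by (cases d) (auto simp: cell_mean_def)

lemma cell_mean_diff:
  assumes "continuous_on {c - 1/2..c + 1/2} f" "continuous_on {c - 1/2..c + 1/2} g"
  shows "cell_mean d c (\<lambda>t. f t - g t) = cell_mean d c f - cell_mean d c g"
  using assms by (cases d) (auto simp: cell_mean_def integral_diff integrable_continuous_real)

lemma cell_mean_const [simp]: "cell_mean d c (\<lambda>t. a) = a"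
  by (cases d) (auto simp: cell_mean_def)

lemma cell_mean_cong:
  assumes "\<And>t. t \<in> {c - 1/2..c + 1/2} \<Longrightarrow> f t = g t"
  shows "cell_mean d c f = cell_mean d c g"
  using assms by (cases d) (auto simp: cell_mean_def intro!: integral_cong)

lemma cell_mean_shift: "cell_mean d (c + a) g = cell_mean d c (\<lambda>t. g (t + a))"
proof (cases d)
  case Cell_Averages
  then show ?thesis
    using integral_affine_Icc[of 1 a "c - 1/2" "c + 1/2" g]
    by (simp add: cell_mean_def algebra_simps)
qed (simp add: cell_mean_def)

lemma cell_mean_reflect: "cell_mean d (- c) g = cell_mean d c (\<lambda>t. g (- t))"
proof (cases d)
  case Cell_Averages
  then show ?thesis
    using Henstock_Kurzweil_Integration.integral_reflect_real[of "c + 1/2" "c - 1/2" "\<lambda>t. g (- t)"]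
    by (simp add: cell_mean_def algebra_simps)
qed (simp add: cell_mean_def)

section \<open>Data of polynomials and unisolvence of the interpolation problem\<close>

lemma cell_mean_poly_add:
  "cell_mean d c (poly (p + q)) = cell_mean d c (poly p) + cell_mean d c (poly q)"
  unfolding poly_add by (intro cell_mean_add continuous_intros)

lemma cell_mean_poly_smult: "cell_mean d c (poly (smult a p)) = a * cell_mean d c (poly p)"
  unfolding poly_smult by (rule cell_mean_cmult)

lemma cell_mean_poly_diff:
  "cell_mean d c (poly (p - q)) = cell_mean d c (poly p) - cell_mean d c (poly q)"
  unfolding poly_diff by (intro cell_mean_diff continuous_intros)

lemma cell_mean_poly_const: "cell_mean d c (poly [:a:]) = a"
proof -
  have "poly [:a:] = (\<lambda>_. a)"
    by auto
  then show ?thesis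
    by simp
qed

lemma cell_mean_poly_sum:
  "cell_mean d c (poly (\<Sum>x\<in>S. p x)) = (\<Sum>x\<in>S. cell_mean d c (poly (p x)))"
proof (induction S rule: infinite_finite_induct)
  case (insert x S)
  then show ?case
    by (simp add: cell_mean_poly_add del: poly_add)
qed (use cell_mean_poly_const[of d c 0] in simp_all)

text \<open>Each zero datum yields a root in the open cell of \<open>j\<close>. These cells are
  disjoint, so a nonzero \<open>p\<close> would have at least \<open>card S\<close> roots, more than
  its degree.\<close>

lemma cell_mean_poly_eq_0_imp:
  assumes "finite S" "degree p < card S" "\<And>j. j \<in> S \<Longrightarrow> cell_mean d (\<alpha> + of_int j) (poly p) = 0"
  shows "p = 0"
proof (rule ccontr)
  assume "p \<noteq> 0"
  have "\<forall>j\<in>S. \<exists>\<xi>. \<alpha> + of_int j - 1/2 < \<xi> \<and> \<xi> < \<alpha> + of_int j + 1/2 \<and> poly p \<xi> = 0"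
  proof
    fix j assume "j \<in> S"
    have "continuous_on {\<alpha> + of_int j - 1/2..\<alpha> + of_int j + 1/2} (poly p)"
      by (intro continuous_intros)
    from cell_mean_eq[OF this, of d]
    show "\<exists>\<xi>. \<alpha> + of_int j - 1/2 < \<xi> \<and> \<xi> < \<alpha> + of_int j + 1/2 \<and> poly p \<xi> = 0"
      using assms(3)[OF \<open>j \<in> S\<close>] by auto
  qed
  from bchoice[OF this] obtain \<xi> where \<xi>: "\<forall>j\<in>S.
      \<alpha> + of_int j - 1/2 < \<xi> j \<and> \<xi> j < \<alpha> + of_int j + 1/2 \<and> poly p (\<xi> j) = 0"
    by blast
  have "inj_on \<xi> S"
  proof
    fix j j' assume "j \<in> S" "j' \<in> S" "\<xi> j = \<xi> j'"
    with \<xi> have "\<alpha> + of_int j - 1/2 < \<xi> j" "\<xi> j < \<alpha> + of_int j + 1/2"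
      "\<alpha> + of_int j' - 1/2 < \<xi> j" "\<xi> j < \<alpha> + of_int j' + 1/2"
      by auto
    then have "\<bar>real_of_int j - of_int j'\<bar> < 1"
      by linarith
    then show "j = j'"
      by linarith
  qed
  then have "card S = card (\<xi> ` S)"
    by (simp add: card_image)
  also have "\<dots> \<le> card {x. poly p x = 0}"
    using \<xi> by (intro card_mono poly_roots_finite \<open>p \<noteq> 0\<close>) auto
  also have "\<dots> \<le> degree p"
    by (rule card_poly_roots_bound[OF \<open>p \<noteq> 0\<close>])
  finally show False
    using assms(2) by simp
qed

text \<open>Newton interpolation, with \<open>w\<close> in the role of the node polynomial: the
  monomial of degree \<open>card S\<close> minus its interpolant \<open>u\<close> is monic and has
  zero data on \<open>S\<close>. By uniqueness its datum at the new index \<open>x\<close> is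
  nonzero, so a multiple of \<open>w\<close> corrects the value there.\<close>

lemma cell_mean_poly_interpolation:
  assumes "finite S" "S \<noteq> {}"
  shows "\<exists>p. degree p < card S \<and> (\<forall>j\<in>S. cell_mean d (\<alpha> + of_int j) (poly p) = y j)"
  using assms
proof (induction S arbitrary: y rule: finite_ne_induct)
  case (singleton x)
  show ?case
    by (rule exI[of _ "[:y x:]"]) (simp add: cell_mean_poly_const del: poly_pCons)
next
  case (insert x S)
  let ?n = "card S"
  obtain u where u: "degree u < ?n"
      "\<forall>j\<in>S. cell_mean d (\<alpha> + of_int j) (poly u) = cell_mean d (\<alpha> + of_int j) (poly (monom 1 ?n))"
    using insert.IH[of "\<lambda>j. cell_mean d (\<alpha> + of_int j) (poly (monom 1 ?n))"] by auto
  define w where "w = monom 1 ?n - u"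
  have "coeff w ?n = 1"
    using u(1) by (simp add: w_def coeff_eq_0)
  then have "w \<noteq> 0"
    by auto
  have deg_w: "degree w \<le> ?n"
    unfolding w_def using u(1) by (intro degree_diff_le degree_monom_le) simp
  have w0: "\<forall>j\<in>S. cell_mean d (\<alpha> + of_int j) (poly w) = 0"
    using u(2) by (simp add: w_def cell_mean_poly_diff del: poly_diff)
  let ?m = "\<lambda>p. cell_mean d (\<alpha> + of_int x) (poly p)"
  have wx: "?m w \<noteq> 0"
    using cell_mean_poly_eq_0_imp[of "insert x S" w d \<alpha>] insert.hyps deg_w w0 \<open>w \<noteq> 0\<close>
    by (auto simp: card_insert_if)
  obtain v where v: "degree v < ?n" "\<forall>j\<in>S. cell_mean d (\<alpha> + of_int j) (poly v) = y j"
    using insert.IH[of y] by auto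
  let ?p = "v + smult ((y x - ?m v) / ?m w) w"
  have "degree ?p \<le> ?n"
    using v(1) deg_w by (intro degree_add_le) (auto intro: order_trans[OF degree_smult_le])
  moreover have "\<forall>j\<in>insert x S. cell_mean d (\<alpha> + of_int j) (poly ?p) = y j"
    using v(2) w0 wx by (simp add: cell_mean_poly_add cell_mean_poly_smult del: poly_add poly_smult)
  ultimately show ?case
    using insert.hyps
    by (intro exI[of _ ?p]) (simp add: less_Suc_eq_le del: poly_add poly_smult)
qed

section \<open>Coincidence of adjacent data of a power\<close>

lemma power_strict_mono_odd:
  fixes a b :: "'a::linordered_idom"
  assumes "odd n" "a < b"
  shows "a ^ n < b ^ n"
proof (cases "0 \<le> a")
  case True
  then show ?thesis
    using assms by (simp add: power_strict_mono odd_pos)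
next
  case False
  show ?thesis
  proof (cases "0 \<le> b")
    case True
    then have "0 \<le> b ^ n"
      by simp
    moreover have "a ^ n < 0"
      using False assms by simp
    ultimately show ?thesis
      by linarith
  next
    case False
    then have "(- b) ^ n < (- a) ^ n"
      using assms by (intro power_strict_mono) (auto simp: odd_pos)
    then show ?thesis
      using assms by simp
  qed
qed

text \<open>The derivative is \<open>n\<close> times the increment of an odd power, hence positive
  on the whole line.\<close>

lemma strict_mono_power_Suc_diff:
  assumes "even n" "n > 0"
  shows "strict_mono (\<lambda>t::real. (t + 1) ^ n - t ^ n)"
proof (rule strict_monoI, rule DERIV_pos_imp_increasing, assumption)
  fix a b t :: real
  have "odd (n - 1)"
    using assms by auto
  then have "t ^ (n - 1) < (t + 1) ^ (n - 1)"
    by (intro power_strict_mono_odd) auto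
  moreover have "((\<lambda>t. (t + 1) ^ n - t ^ n) has_real_derivative
      real n * (t + 1) ^ (n - 1) - real n * t ^ (n - 1)) (at t)"
    by (auto intro!: derivative_eq_intros)
  ultimately show "\<exists>y. ((\<lambda>t. (t + 1) ^ n - t ^ n) has_real_derivative y) (at t) \<and> y > 0"
    using assms(2) by (intro exI[of _ "real n * (t + 1) ^ (n - 1) - real n * t ^ (n - 1)"]) auto
qed

text \<open>The hypothesis says that the increment \<open>G\<close> of the power has mean zero on
  the cell at \<open>c\<close>. For odd \<open>N\<close> this fails because \<open>G\<close> is
  positive. For even \<open>N\<close>, \<open>G\<close> is injective and odd about
  \<open>- 1/2\<close>, which leaves only the cell centred there.\<close>

lemma cell_mean_power_adjacent_eq:
  assumes "N > 0" "cell_mean d c (\<lambda>t. t ^ N) = cell_mean d (c + 1) (\<lambda>t. t ^ N)"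
  shows "even N \<and> c = - 1/2"
proof -
  define G where "G = (\<lambda>t::real. (t + 1) ^ N - t ^ N)"
  have contG: "continuous_on A (\<lambda>t. G (t + b))" "continuous_on A G" for A b
    unfolding G_def by (intro continuous_intros)+
  have meanG: "cell_mean d c G = 0"
    using assms(2) unfolding G_def cell_mean_shift[of d c 1]
    by (subst cell_mean_diff) (auto intro!: continuous_intros)
  have "even N"
  proof (rule ccontr)
    assume "odd N"
    then have "G t > 0" for t
      using power_strict_mono_odd[of N t "t + 1"] by (simp add: G_def)
    then show False
      using cell_mean_eq[OF contG(2), of c d] meanG by (metis less_irrefl)
  qed
  \<comment> \<open>Reflection about \<open>- 1/2\<close> sends \<open>t\<close> to
    \<open>- t - 1\<close>, changes the sign of \<open>G\<close> and moves the cell at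
    \<open>c\<close> to the cell at \<open>- 1 - c\<close>.\<close>
  have "cell_mean d (- 1 - c) G = - cell_mean d c G"
  proof -
    have "cell_mean d (- 1 - c) G = cell_mean d (- c) (\<lambda>t. G (t - 1))"
      using cell_mean_shift[of d "- c" "- 1" G] by (simp add: algebra_simps)
    also have "\<dots> = cell_mean d c (\<lambda>t. G (- t - 1))"
      by (rule cell_mean_reflect)
    also have "(\<lambda>t. G (- t - 1)) = (\<lambda>t. (- 1) * G t)"
    proof
      fix t :: real
      have "(- t - 1) ^ N = (- (t + 1)) ^ N"
        by (rule arg_cong[of _ _ "\<lambda>x. x ^ N"]) simp
      also have "\<dots> = (t + 1) ^ N"
        by (rule power_minus_even[OF \<open>even N\<close>])
      finally show "G (- t - 1) = (- 1) * G t"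
        using \<open>even N\<close> by (simp add: G_def)
    qed
    finally show ?thesis
      by (simp only: cell_mean_cmult)
  qed
  moreover have "cell_mean d (- 1 - c) G = cell_mean d (c + (- 1 - 2 * c)) G"
    by (rule arg_cong[of _ _ "\<lambda>x. cell_mean d x G"]) simp
  ultimately have "cell_mean d c (\<lambda>t. G (t + (- 1 - 2 * c))) = 0"
    using meanG by (simp only: cell_mean_shift[of d c "- 1 - 2 * c" G])
  \<comment> \<open>The means over the cell and its mirror image both vanish. The mirror image is a
    translate by \<open>- 1 - 2 * c\<close>, so the mean value property gives a point where
    \<open>G\<close> agrees with its translate; injectivity makes the translation zero.\<close>
  then have "cell_mean d c (\<lambda>t. G t - G (t + (- 1 - 2 * c))) = 0"
    using meanG by (subst cell_mean_diff) (auto intro!: contG)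
  moreover have "continuous_on {c - 1/2..c + 1/2} (\<lambda>t. G t - G (t + (- 1 - 2 * c)))"
    by (intro continuous_on_diff contG)
  then obtain \<xi> where "cell_mean d c (\<lambda>t. G t - G (t + (- 1 - 2 * c))) = G \<xi> - G (\<xi> + (- 1 - 2 * c))"
    by (rule cell_mean_eq)
  ultimately have "G \<xi> = G (\<xi> + (- 1 - 2 * c))"
    by simp
  moreover have "inj G"
    unfolding G_def
    by (rule strict_mono_imp_inj_on[OF strict_mono_power_Suc_diff[OF \<open>even N\<close> \<open>N > 0\<close>]])
  ultimately have "\<xi> = \<xi> + (- 1 - 2 * c)"
    by (rule injD[rotated])
  with \<open>even N\<close> show ?thesis
    by simp
qed

section \<open>The smoothness indicator as a quadratic form\<close>

text \<open>The smoothness indicator for \<open>z = 0\<close> and \<open>h = 1\<close>, as a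
  functional of the polynomial; the interval is the cell of the node with index 0.\<close>

definition energy :: "real \<Rightarrow> nat \<Rightarrow> real poly \<Rightarrow> real" where
  "energy \<alpha> r P =
     (\<Sum>l = 1..r - 1. integral {\<alpha> - 1/2..\<alpha> + 1/2} (\<lambda>t. (poly ((pderiv ^^ l) P) t)\<^sup>2))"

section \<open>Affine substitution and invariances of the energy\<close>

lemma higher_pderiv_pcompose_linear:
  "(pderiv ^^ l) (pcompose P [:a, b:]) = smult (b ^ l) (pcompose ((pderiv ^^ l) P) [:a, b:])"
  by (induction l)
     (simp_all add: pderiv_smult pderiv_pcompose pderiv_pCons mult.commute)

lemma higher_pderiv_pCons_0: "l > 0 \<Longrightarrow> (pderiv ^^ l) [:a:] = 0"
  by (cases l) (simp_all add: funpow_Suc_right pderiv_pCons del: funpow.simps)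

text \<open>The sum starts at \<open>l = 1\<close>, so constants drop out. This discards the common
  datum of \<open>e\<close> and extracts the factor \<open>h ^ (2 * N)\<close>.\<close>

lemma energy_smult_add_const: "energy \<alpha> r (smult a P + [:b:]) = a\<^sup>2 * energy \<alpha> r P"
proof -
  have "(poly ((pderiv ^^ l) (smult a P + [:b:])) t)\<^sup>2 = a\<^sup>2 * (poly ((pderiv ^^ l) P) t)\<^sup>2"
    if "l \<in> {1..r - 1}" for l t
    using that
    by (simp add: higher_pderiv_add higher_pderiv_smult higher_pderiv_pCons_0 power_mult_distrib del: One_nat_def)
  then show ?thesis
    by (simp add: energy_def sum_distrib_left)
qed

text \<open>The substitution \<open>x = z + t * h\<close> is invertible, preserves degrees and turns
  the conditions into ones on \<open>r\<close> unit cells, where uniqueness is known. This resolves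
  the \<open>THE\<close> in \<open>recon_poly\<close>.\<close>

lemma recon_poly_eqI:
  assumes "h > 0" "r > 0" "degree P \<le> r - 1"
    and "\<And>j. j \<in> {- int r + 1 + int i..int i} \<Longrightarrow>
           cell_mean d (\<alpha> + of_int j) (poly P) = datum d z \<alpha> h f j"
  shows "recon_poly d z \<alpha> h r i f = pcompose P [:- (z / h), 1 / h:]"
proof -
  let ?S = "{- int r + 1 + int i..int i}"
  have datum_poly: "datum d z \<alpha> h (poly p) j = cell_mean d (\<alpha> + of_int j) (poly (pcompose p [:z, h:]))"
    for p j
  proof -
    have "poly (pcompose p [:z, h:]) = (\<lambda>t. poly p (z + t * h))"
      by (simp add: fun_eq_iff poly_pcompose mult.commute)
    then show ?thesis
      using assms(1) by (simp add: datum_eq_cell_mean)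
  qed
  have inv: "pcompose (pcompose p [:z, h:]) [:- (z / h), 1 / h:] = p"
    "pcompose (pcompose p [:- (z / h), 1 / h:]) [:z, h:] = p" for p
    using assms(1) by (simp_all add: pcompose_assoc[symmetric] pcompose_pCons flip: one_poly_def)
  show ?thesis
    unfolding recon_poly_def
  proof (rule the_equality)
    show "degree (pcompose P [:- (z / h), 1 / h:]) \<le> r - 1 \<and>
        (\<forall>j\<in>?S. datum d z \<alpha> h (poly (pcompose P [:- (z / h), 1 / h:])) j = datum d z \<alpha> h f j)"
      using assms by (simp add: datum_poly inv degree_pcompose)
  next
    fix p
    assume p: "degree p \<le> r - 1 \<and> (\<forall>j\<in>?S. datum d z \<alpha> h (poly p) j = datum d z \<alpha> h f j)"
    have "pcompose p [:z, h:] - P = 0"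
    proof (rule cell_mean_poly_eq_0_imp[of ?S _ d \<alpha>])
      show "degree (pcompose p [:z, h:] - P) < card ?S"
        using p assms by (intro degree_diff_less) (auto simp: degree_pcompose)
      show "cell_mean d (\<alpha> + of_int j) (poly (pcompose p [:z, h:] - P)) = 0" if "j \<in> ?S" for j
        using p that assms(4)[OF that] unfolding cell_mean_poly_diff
        by (simp add: datum_poly)
    qed auto
    then show "p = pcompose P [:- (z / h), 1 / h:]"
      using inv(1)[of p] by simp
  qed
qed

text \<open>The squared derivative of order \<open>l\<close> scales by the power
  \<open>- 2 * l\<close> of \<open>h\<close>, which the weight \<open>h ^ (2 * l - 1)\<close> and
  the factor \<open>h\<close> from the change of variable cancel.\<close>

lemma smoothness_indicator_eq_energy:
  assumes "h > 0" "r > 0" "degree P \<le> r - 1"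
    and "\<And>j. j \<in> {- int r + 1 + int i..int i} \<Longrightarrow>
           cell_mean d (\<alpha> + of_int j) (poly P) = datum d z \<alpha> h f j"
  shows "smoothness_indicator d z \<alpha> h r i f = energy \<alpha> r P"
proof -
  have recon: "recon_poly d z \<alpha> h r i f = pcompose P [:- (z / h), 1 / h:]"
    by (rule recon_poly_eqI) (use assms in auto)
  show ?thesis
    unfolding smoothness_indicator_def energy_def
  proof (rule sum.cong)
    fix l assume l: "l \<in> {1..r - 1}"
    let ?D = "(pderiv ^^ l) P"
    have "integral {node z \<alpha> h (- 1/2)..node z \<alpha> h (1/2)}
        (\<lambda>x. h ^ (2 * l - 1) * (poly ((pderiv ^^ l) (recon_poly d z \<alpha> h r i f)) x)\<^sup>2)
        = h * integral {\<alpha> - 1/2..\<alpha> + 1/2} (\<lambda>t. h ^ (2 * l - 1) * (1 / h ^ l * poly ?D t)\<^sup>2)"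
    proof -
      have "poly (pcompose ?D [:- (z / h), 1 / h:]) (z + t * h) = poly ?D t" for t
        using assms(1) by (simp add: poly_pcompose add_divide_distrib)
      then show ?thesis
        unfolding recon higher_pderiv_pcompose_linear node_def
        using integral_affine_Icc[OF assms(1), of z "\<alpha> - 1/2" "\<alpha> + 1/2"]
        by (simp add: power_one_over)
    qed
    also have "(\<lambda>t. h ^ (2 * l - 1) * (1 / h ^ l * poly ?D t)\<^sup>2) = (\<lambda>t. 1 / h * (poly ?D t)\<^sup>2)"
    proof
      fix t
      \<comment> \<open>The exponent is a natural subtraction, exact because \<open>l\<close> is at
        least 1.\<close>
      have "h ^ (2 * l - 1) * h = (h ^ l)\<^sup>2"
        using l by (cases l) (simp_all add: power2_eq_square power_add mult_2)
      then show "h ^ (2 * l - 1) * (1 / h ^ l * poly ?D t)\<^sup>2 = 1 / h * (poly ?D t)\<^sup>2"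
        using assms(1) by (simp add: power_mult_distrib field_simps)
    qed
    finally show "integral {node z \<alpha> h (- 1/2)..node z \<alpha> h (1/2)}
        (\<lambda>x. h ^ (2 * l - 1) * (poly ((pderiv ^^ l) (recon_poly d z \<alpha> h r i f)) x)\<^sup>2)
        = integral {\<alpha> - 1/2..\<alpha> + 1/2} (\<lambda>t. (poly ?D t)\<^sup>2)"
      using assms(1) by simp
  qed simp
qed

text \<open>The term \<open>l = 1\<close>, present since \<open>r \<ge> 2\<close>, is already
  positive: a nonzero polynomial cannot vanish on a whole cell.\<close>

lemma energy_pos:
  assumes "r \<ge> 2" "pderiv P \<noteq> 0"
  shows "energy \<alpha> r P > 0"
proof -
  let ?I = "\<lambda>l. integral {\<alpha> - 1/2..\<alpha> + 1/2} (\<lambda>t. (poly ((pderiv ^^ l) P) t)\<^sup>2)"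
  have nonneg: "?I l \<ge> 0" for l
    by (intro integral_nonneg integrable_continuous_real continuous_intros) auto
  have "?I 1 \<noteq> 0"
  proof
    assume "?I 1 = 0"
    moreover have "continuous_on {\<alpha> - 1/2..\<alpha> + 1/2} (\<lambda>t. (poly ((pderiv ^^ 1) P) t)\<^sup>2)"
      by (intro continuous_intros)
    ultimately have "\<forall>t\<in>{\<alpha> - 1/2..\<alpha> + 1/2}. poly (pderiv P) t = 0"
      using integral_eq_0_iff[of "\<alpha> - 1/2" "\<alpha> + 1/2" "\<lambda>t. (poly ((pderiv ^^ 1) P) t)\<^sup>2"] by simp
    then have "{\<alpha> - 1/2..\<alpha> + 1/2} \<subseteq> {t. poly (pderiv P) t = 0}"
      by auto
    with poly_roots_finite[OF assms(2)] have "finite {\<alpha> - 1/2..\<alpha> + 1/2}"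
      by (rule finite_subset[rotated])
    then show False
      using infinite_Icc[of "\<alpha> - 1/2" "\<alpha> + 1/2"] by simp
  qed
  with nonneg[of 1] have "?I 1 > 0"
    by simp
  also have "?I 1 \<le> energy \<alpha> r P"
    unfolding energy_def using assms(1) nonneg by (intro member_le_sum) auto
  finally show ?thesis .
qed

text \<open>Expanding the squares gives a quadratic form with fixed matrix in finitely many
  coefficients, hence a continuous function of them.\<close>

lemma tendsto_energy:
  assumes "finite S" "\<And>j. j \<in> S \<Longrightarrow> ((\<lambda>h. a h j) \<longlongrightarrow> q j) F"
  shows "((\<lambda>h. energy \<alpha> r (\<Sum>j\<in>S. smult (a h j) (E j))) \<longlongrightarrow>
           energy \<alpha> r (\<Sum>j\<in>S. smult (q j) (E j))) F"
proof -
  have "energy \<alpha> r (\<Sum>j\<in>S. smult (b j) (E j)) =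
      (\<Sum>l = 1..r - 1. \<Sum>j\<in>S. \<Sum>k\<in>S. b j * b k *
        integral {\<alpha> - 1/2..\<alpha> + 1/2} (\<lambda>t. poly ((pderiv ^^ l) (E j)) t * poly ((pderiv ^^ l) (E k)) t))"
    for b
  proof -
    have "(poly ((pderiv ^^ l) (\<Sum>j\<in>S. smult (b j) (E j))) t)\<^sup>2 = (\<Sum>j\<in>S. \<Sum>k\<in>S. b j * b k *
        (poly ((pderiv ^^ l) (E j)) t * poly ((pderiv ^^ l) (E k)) t))" for l t
      by (simp add: higher_pderiv_sum higher_pderiv_smult poly_sum power2_eq_square sum_product algebra_simps)
    moreover have "integral {\<alpha> - 1/2..\<alpha> + 1/2} (\<lambda>t. \<Sum>j\<in>S. \<Sum>k\<in>S. b j * b k *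
        (poly ((pderiv ^^ l) (E j)) t * poly ((pderiv ^^ l) (E k)) t)) =
        (\<Sum>j\<in>S. \<Sum>k\<in>S. b j * b k *
        integral {\<alpha> - 1/2..\<alpha> + 1/2} (\<lambda>t. poly ((pderiv ^^ l) (E j)) t * poly ((pderiv ^^ l) (E k)) t))" for l
      using assms(1)
      by (subst integral_sum | simp add: integrable_continuous_real continuous_intros)+
    ultimately show ?thesis
      unfolding energy_def by simp
  qed
  then show ?thesis
    by (auto intro!: tendsto_intros assms(2))
qed

section \<open>Leading asymptotics\<close>

text \<open>Lagrange cardinal polynomials for the scaled stencil. They do not depend on
  \<open>h\<close>, so convergence of reconstructions reduces to convergence of data.\<close>

lemma cell_mean_poly_delta_basis:
  assumes "r > 0"
  shows "\<exists>E. (\<forall>k. degree (E k) \<le> r - 1) \<and>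
    (\<forall>y. \<forall>j\<in>{- int r + 1 + int i..int i}. cell_mean d (\<alpha> + of_int j)
       (poly (\<Sum>k\<in>{- int r + 1 + int i..int i}. smult (y k) (E k))) = y j)"
proof -
  let ?S = "{- int r + 1 + int i..int i}"
  have "\<exists>p. degree p < card ?S \<and> (\<forall>j\<in>?S. cell_mean d (\<alpha> + of_int j) (poly p) = (if j = k then 1 else 0))"
    for k
    using assms by (intro cell_mean_poly_interpolation) auto
  then obtain E where E: "\<And>k. degree (E k) < card ?S"
      "\<And>k j. j \<in> ?S \<Longrightarrow> cell_mean d (\<alpha> + of_int j) (poly (E k)) = (if j = k then 1 else 0)"
    by metis
  show ?thesis
  proof (intro exI conjI allI ballI)
    show "degree (E k) \<le> r - 1" for k
      using E(1)[of k] assms by simp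
    show "cell_mean d (\<alpha> + of_int j) (poly (\<Sum>k\<in>?S. smult (y k) (E k))) = y j" if "j \<in> ?S" for j y
    proof -
      have "cell_mean d (\<alpha> + of_int j) (poly (\<Sum>k\<in>?S. smult (y k) (E k)))
          = (\<Sum>k\<in>?S. y k * (if j = k then 1 else 0))"
        unfolding cell_mean_poly_sum cell_mean_poly_smult E(2)[OF that] ..
      also have "\<dots> = y j"
        using that by (simp add: if_distrib[of "(*) _"] sum.delta cong: if_cong)
      finally show ?thesis .
    qed
  qed
qed

lemma continuous_on_scaled_cell:
  fixes g :: "real \<Rightarrow> real"
  assumes "continuous_on (ball 0 \<delta>) g" "h > 0" "h * (\<bar>c\<bar> + 1) < \<delta>"
  shows "continuous_on {c - 1/2..c + 1/2} (\<lambda>t. g (t * h))"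
proof (rule continuous_on_compose2[OF assms(1)])
  show "(\<lambda>t. t * h) ` {c - 1/2..c + 1/2} \<subseteq> ball 0 \<delta>"
  proof clarsimp
    fix t assume "c - 1/2 \<le> t" "t \<le> c + 1/2"
    then have "\<bar>t * h\<bar> \<le> h * (\<bar>c\<bar> + 1)"
      using assms(2) by (subst abs_mult, subst mult.commute, intro mult_mono) auto
    then show "\<bar>t * h\<bar> < \<delta>"
      using assms(3) by (rule le_less_trans)
  qed
qed (intro continuous_intros)

text \<open>The remainder \<open>g (t * h) - C * h ^ N * t ^ N\<close> is small against
  \<open>h ^ N\<close> uniformly on the cell, and its datum is one of its values there.\<close>

lemma tendsto_cell_mean_scaled:
  fixes g :: "real \<Rightarrow> real"
  assumes "N > 0" "\<delta> > 0" "continuous_on (ball 0 \<delta>) g" "g 0 = 0"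
    and lim: "((\<lambda>y. g y / y ^ N) \<longlongrightarrow> C) (at 0)"
  shows "((\<lambda>h. cell_mean d c (\<lambda>t. g (t * h)) / h ^ N) \<longlongrightarrow> C * cell_mean d c (\<lambda>t. t ^ N)) (at_right 0)"
proof (rule tendstoI)
  fix e :: real assume "e > 0"
  define M where "M = \<bar>c\<bar> + 1"
  \<comment> \<open>\<open>M\<close> bounds the absolute value of \<open>t\<close> on the cell; with
    this \<open>\<epsilon>\<close> the final error is \<open>e / 2 * h ^ N\<close>.\<close>
  define \<epsilon> where "\<epsilon> = e / (2 * M ^ N)"
  have "M > 0"
    by (simp add: M_def)
  then have "\<epsilon> > 0"
    using \<open>e > 0\<close> by (simp add: \<epsilon>_def)
  then obtain \<eta> where \<eta>: "\<eta> > 0" "\<And>y. y \<noteq> 0 \<Longrightarrow> \<bar>y\<bar> < \<eta> \<Longrightarrow> \<bar>g y / y ^ N - C\<bar> < \<epsilon>"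
    using tendstoD[OF lim \<open>\<epsilon> > 0\<close>] by (auto simp: eventually_at dist_real_def)
  \<comment> \<open>The limit at 0 says nothing about \<open>y = 0\<close>; there both sides vanish
    by \<open>g 0 = 0\<close> and \<open>N > 0\<close>.\<close>
  have rem: "\<bar>g y - C * y ^ N\<bar> \<le> \<epsilon> * \<bar>y\<bar> ^ N" if "\<bar>y\<bar> < \<eta>" for y
  proof (cases "y = 0")
    case True
    then show ?thesis
      using \<open>N > 0\<close> \<open>g 0 = 0\<close> by (simp add: zero_power)
  next
    case False
    have "\<bar>g y - C * y ^ N\<bar> = \<bar>g y / y ^ N - C\<bar> * \<bar>y\<bar> ^ N"
      using False by (simp add: power_abs[symmetric] abs_mult[symmetric] field_simps)
    also have "\<dots> \<le> \<epsilon> * \<bar>y\<bar> ^ N"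
      using \<eta>(2)[OF False that] by (intro mult_right_mono) auto
    finally show ?thesis .
  qed
  have close: "dist (cell_mean d c (\<lambda>t. g (t * h)) / h ^ N) (C * cell_mean d c (\<lambda>t. t ^ N)) < e"
    if h: "0 < h" "h < min \<eta> \<delta> / M" for h
  proof -
    have hM: "h * M < \<eta>" "h * M < \<delta>"
      using h \<open>M > 0\<close> by (auto simp: field_simps)
    have cont: "continuous_on {c - 1/2..c + 1/2} (\<lambda>t. g (t * h))"
      using assms(3) h(1) hM(2) unfolding M_def by (rule continuous_on_scaled_cell)
    have "continuous_on {c - 1/2..c + 1/2} (\<lambda>t. g (t * h) - C * h ^ N * t ^ N)"
      by (intro continuous_intros cont)
    then obtain \<xi> where \<xi>: "c - 1/2 < \<xi>" "\<xi> < c + 1/2"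
        "cell_mean d c (\<lambda>t. g (t * h) - C * h ^ N * t ^ N) = g (\<xi> * h) - C * h ^ N * \<xi> ^ N"
      by (rule cell_mean_eq)
    have "\<bar>\<xi>\<bar> \<le> M"
      using \<xi> by (simp add: M_def)
    then have \<xi>h: "\<bar>\<xi> * h\<bar> \<le> M * h"
      using h(1) by (simp add: abs_mult mult_right_mono)
    have "\<bar>g (\<xi> * h) - C * h ^ N * \<xi> ^ N\<bar> = \<bar>g (\<xi> * h) - C * (\<xi> * h) ^ N\<bar>"
      by (simp add: power_mult_distrib algebra_simps)
    also have "\<dots> \<le> \<epsilon> * \<bar>\<xi> * h\<bar> ^ N"
      using \<xi>h hM by (intro rem) (simp add: mult.commute)
    also have "\<dots> \<le> \<epsilon> * (M * h) ^ N"
      using \<xi>h \<open>\<epsilon> > 0\<close> by (intro mult_left_mono power_mono) auto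
    also have "\<dots> = e / 2 * h ^ N"
      using \<open>M > 0\<close> by (simp add: \<epsilon>_def power_mult_distrib)
    finally have "\<bar>cell_mean d c (\<lambda>t. g (t * h) - C * h ^ N * t ^ N)\<bar> \<le> e / 2 * h ^ N"
      by (simp only: \<xi>(3))
    moreover have "cell_mean d c (\<lambda>t. g (t * h) - C * h ^ N * t ^ N) =
        cell_mean d c (\<lambda>t. g (t * h)) - C * h ^ N * cell_mean d c (\<lambda>t. t ^ N)"
      unfolding cell_mean_cmult[symmetric] by (intro cell_mean_diff continuous_intros cont)
    moreover have "cell_mean d c (\<lambda>t. g (t * h)) / h ^ N - C * cell_mean d c (\<lambda>t. t ^ N)
        = (cell_mean d c (\<lambda>t. g (t * h)) - C * h ^ N * cell_mean d c (\<lambda>t. t ^ N)) / h ^ N"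
      using h(1) by (simp add: diff_divide_distrib)
    ultimately have "\<bar>cell_mean d c (\<lambda>t. g (t * h)) / h ^ N - C * cell_mean d c (\<lambda>t. t ^ N)\<bar> \<le> e / 2"
      using h(1) by (simp add: pos_divide_le_eq)
    then show ?thesis
      using \<open>e > 0\<close> by (simp add: dist_real_def)
  qed
  have "min \<eta> \<delta> / M > 0"
    using \<eta>(1) \<open>\<delta> > 0\<close> \<open>M > 0\<close> by simp
  then show "\<forall>\<^sub>F h in at_right 0.
      dist (cell_mean d c (\<lambda>t. g (t * h)) / h ^ N) (C * cell_mean d c (\<lambda>t. t ^ N)) < e"
    using close by (auto simp: eventually_at_right_field)
qed

section \<open>Exact order of the indicator\<close>

lemma exact_orderI:
  assumes "((\<lambda>h. g h * h powr (- a)) \<longlongrightarrow> L) (at_right 0)" "L > 0"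
  shows "exact_order g a"
proof -
  have "((\<lambda>h. ereal \<bar>g h * h powr (- a)\<bar>) \<longlongrightarrow> ereal \<bar>L\<bar>) (at_right 0)"
    using assms(1) by (intro tendsto_ereal tendsto_rabs)
  then have "Limsup (at_right 0) (\<lambda>h. ereal \<bar>g h * h powr (- a)\<bar>) = ereal \<bar>L\<bar>"
    "Liminf (at_right 0) (\<lambda>h. ereal \<bar>g h * h powr (- a)\<bar>) = ereal \<bar>L\<bar>"
    by (auto intro!: lim_imp_Limsup lim_imp_Liminf simp del: abs_ereal.simps tendsto_ereal)
  then show ?thesis
    using assms(2) unfolding exact_order_def by simp
qed

text \<open>The common datum \<open>A h\<close> of \<open>e\<close> may vary with \<open>h\<close>
  but not with \<open>j\<close>, so the reconstruction is \<open>h ^ N\<close> times that of the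
  scaled data of \<open>g\<close>, up to a constant. The scaled data converge to those of
  \<open>C * t ^ N\<close>, and the pair \<open>j\<close>, \<open>j + 1\<close> keeps the limit
  energy positive.\<close>

lemma exact_order_smoothness_indicator:
  fixes f e g :: "real \<Rightarrow> real" and A :: "real \<Rightarrow> real"
  assumes "r \<ge> 2" "N > 0" "\<delta> > 0"
    and f: "\<And>y. \<bar>y\<bar> < \<delta> \<Longrightarrow> f (z + y) = e y + g y"
    and cont: "continuous_on (ball 0 \<delta>) e" "continuous_on (ball 0 \<delta>) g"
    and e: "\<And>j h. j \<in> {- int r + 1 + int i..int i} \<Longrightarrow> h > 0 \<Longrightarrow>
              cell_mean d (\<alpha> + of_int j) (\<lambda>t. e (t * h)) = A h"
    and g: "g 0 = 0" "((\<lambda>y. g y / y ^ N) \<longlongrightarrow> C) (at 0)" "C \<noteq> 0"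
    and j: "j \<in> {- int r + 1 + int i..<int i}" "cell_mean d (\<alpha> + of_int j) (\<lambda>t. t ^ N) \<noteq>
            cell_mean d (\<alpha> + of_int j + 1) (\<lambda>t. t ^ N)"
  shows "exact_order (\<lambda>h. smoothness_indicator d z \<alpha> h r i f) (2 * real N)"
proof -
  let ?S = "{- int r + 1 + int i..int i}"
  let ?m = "\<lambda>j. cell_mean d (\<alpha> + of_int j)"
  have "r > 0"
    using assms(1) by simp
  obtain E where E: "\<And>j. degree (E j) \<le> r - 1"
      "\<And>j y. j \<in> ?S \<Longrightarrow> ?m j (poly (\<Sum>k\<in>?S. smult (y k) (E k))) = y j"
    using cell_mean_poly_delta_basis[OF \<open>r > 0\<close>, of i d \<alpha>] by blast
  define P where "P = (\<lambda>y. \<Sum>k\<in>?S. smult (y k) (E k))"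
  define a where "a = (\<lambda>h j. ?m j (\<lambda>t. g (t * h)) / h ^ N)"
  define q where "q = (\<lambda>j. C * ?m j (\<lambda>t. t ^ N))"
  have "((\<lambda>h. energy \<alpha> r (P (a h))) \<longlongrightarrow> energy \<alpha> r (P q)) (at_right 0)"
    unfolding P_def a_def q_def
    by (intro tendsto_energy tendsto_cell_mean_scaled[OF assms(2,3) cont(2) g(1,2)]) auto
  moreover have "\<forall>\<^sub>F h in at_right 0.
      energy \<alpha> r (P (a h)) = smoothness_indicator d z \<alpha> h r i f * h powr (- (2 * real N))"
  proof -
    \<comment> \<open>\<open>B\<close> bounds \<open>\<bar>\<alpha> + j\<bar> + 1\<close> over the
      stencil, so for \<open>h < \<delta> / B\<close> every cell lies where the splitting of
      \<open>f\<close> holds.\<close>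
    define B where "B = \<bar>\<alpha>\<bar> + real r + real i + 1"
    have "B > 0"
      by (simp add: B_def)
    have "energy \<alpha> r (P (a h)) = smoothness_indicator d z \<alpha> h r i f * h powr (- (2 * real N))"
      if h: "0 < h" "h < \<delta> / B" for h
    proof -
      have "?m j (poly (smult (h ^ N) (P (a h)) + [:A h:])) = datum d z \<alpha> h f j" if j: "j \<in> ?S" for j
      proof -
        define c where "c = \<alpha> + of_int j"
        have "\<bar>real_of_int j\<bar> \<le> real r + real i"
          using j by (auto simp: abs_le_iff)
        then have "\<bar>c\<bar> + 1 \<le> B"
          unfolding c_def B_def by linarith
        then have "h * (\<bar>c\<bar> + 1) \<le> h * B"
          using h(1) by simp
        also have "\<dots> < \<delta>"
          using h(2) \<open>B > 0\<close> by (simp add: field_simps)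
        finally have hc: "h * (\<bar>c\<bar> + 1) < \<delta>" .
        have "datum d z \<alpha> h f j = cell_mean d c (\<lambda>t. f (z + t * h))"
          using h(1) by (simp add: datum_eq_cell_mean c_def)
        also have "\<dots> = cell_mean d c (\<lambda>t. e (t * h) + g (t * h))"
        proof (rule cell_mean_cong, rule f)
          fix t assume "t \<in> {c - 1/2..c + 1/2}"
          then have "\<bar>t * h\<bar> \<le> h * (\<bar>c\<bar> + 1)"
            using h(1) by (subst abs_mult, subst mult.commute, intro mult_mono) auto
          then show "\<bar>t * h\<bar> < \<delta>"
            using hc by (rule le_less_trans)
        qed
        also have "\<dots> = cell_mean d c (\<lambda>t. e (t * h)) + cell_mean d c (\<lambda>t. g (t * h))"
          by (intro cell_mean_add continuous_on_scaled_cell[OF _ h(1) hc] cont)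
        also have "\<dots> = A h + h ^ N * a h j"
          using e[OF j h(1)] h(1) by (simp add: a_def c_def)
        finally show ?thesis
          using E(2)[OF j, of "a h"]
          by (simp only: cell_mean_poly_add cell_mean_poly_smult cell_mean_poly_const P_def add.commute)
      qed
      moreover have "degree (smult (h ^ N) (P (a h)) + [:A h:]) \<le> r - 1"
        unfolding P_def
        by (intro degree_add_le order_trans[OF degree_smult_le] degree_sum_le E(1)) auto
      ultimately have "smoothness_indicator d z \<alpha> h r i f = energy \<alpha> r (smult (h ^ N) (P (a h)) + [:A h:])"
        using h(1) assms(1) by (intro smoothness_indicator_eq_energy) auto
      also have "\<dots> = h ^ (2 * N) * energy \<alpha> r (P (a h))"
        by (simp only: energy_smult_add_const power_even_eq)
      also have "h ^ (2 * N) = h powr (2 * real N)"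
        using h(1) powr_realpow[of h "2 * N"] by simp
      finally show ?thesis
        using h(1) by (simp add: powr_minus field_simps)
    qed
    moreover have "\<delta> / B > 0"
      using \<open>\<delta> > 0\<close> \<open>B > 0\<close> by simp
    ultimately show ?thesis
      by (auto simp: eventually_at_right_field)
  qed
  ultimately have "((\<lambda>h. smoothness_indicator d z \<alpha> h r i f * h powr (- (2 * real N)))
      \<longlongrightarrow> energy \<alpha> r (P q)) (at_right 0)"
    by (rule Lim_transform_eventually)
  moreover have "pderiv (P q) \<noteq> 0"
  proof
    assume "pderiv (P q) = 0"
    then obtain b where "P q = [:b:]"
      using pderiv_iszero by auto
    then have "q k = b" if "k \<in> ?S" for k
      using E(2)[OF that, of q] by (simp only: P_def cell_mean_poly_const)
    \<comment> \<open>The half-open range of \<open>j\<close> puts \<open>j + 1\<close> in the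
      stencil as well.\<close>
    from this[of j] this[of "j + 1"] have "q j = q (j + 1)"
      using j(1) by simp
    with g(3) j(2) show False
      by (simp add: q_def add.assoc)
  qed
  then have "energy \<alpha> r (P q) > 0"
    using assms(1) by (intro energy_pos)
  ultimately show ?thesis
    by (rule exact_orderI)
qed

section \<open>Taylor expansion\<close>

lemma C_near_le:
  assumes "C_near n f z" "m \<le> n"
  shows "C_near m f z"
proof -
  obtain \<epsilon> where \<epsilon>: "\<epsilon> > 0" "\<forall>k<n. \<forall>x\<in>ball z \<epsilon>. (deriv ^^ k) f field_differentiable at x"
      "continuous_on (ball z \<epsilon>) ((deriv ^^ n) f)"
    using assms(1) by (auto simp: C_near_def)
  have "continuous_on (ball z \<epsilon>) ((deriv ^^ m) f)"
  proof (cases "m = n")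
    case False
    then have "\<forall>x\<in>ball z \<epsilon>. (deriv ^^ m) f field_differentiable at x"
      using \<epsilon>(2) assms(2) by simp
    then show ?thesis
      by (auto intro!: continuous_at_imp_continuous_on field_differentiable_imp_continuous_at)
  qed (use \<epsilon>(3) in simp)
  then show ?thesis
    unfolding C_near_def using \<epsilon>(1,2) assms(2) by (intro exI[of _ \<epsilon>]) auto
qed

text \<open>By Lagrange's form of the remainder the quotient equals the derivative of order
  \<open>n\<close> over \<open>fact n\<close> at a point between \<open>z\<close> and
  \<open>z + y\<close>; continuity of that derivative gives the limit.\<close>

lemma Taylor_remainder_tendsto:
  assumes "C_near n f z"
  shows "((\<lambda>y. (f (z + y) - (\<Sum>m<n. (deriv ^^ m) f z / fact m * y ^ m)) / y ^ n)
           \<longlongrightarrow> (deriv ^^ n) f z / fact n) (at 0)"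
proof (rule tendstoI)
  fix e :: real assume "e > 0"
  obtain \<epsilon> where \<epsilon>: "\<epsilon> > 0" "\<And>k x. k < n \<Longrightarrow> x \<in> ball z \<epsilon> \<Longrightarrow> (deriv ^^ k) f field_differentiable at x"
      "continuous_on (ball z \<epsilon>) ((deriv ^^ n) f)"
    using assms by (auto simp: C_near_def)
  let ?D = "\<lambda>x. (deriv ^^ n) f x / fact n"
  have "continuous_on (ball z \<epsilon>) ?D"
    by (intro continuous_intros \<epsilon>(3)) auto
  then have "isCont ?D z"
    using \<epsilon>(1) by (simp add: continuous_on_eq_continuous_at)
  then obtain \<eta> where \<eta>: "\<eta> > 0" "\<And>x. \<bar>x - z\<bar> < \<eta> \<Longrightarrow> \<bar>?D x - ?D z\<bar> < e"
    using \<open>e > 0\<close> unfolding continuous_at_eps_delta dist_real_def by metis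
  have "dist ((f (z + y) - (\<Sum>m<n. (deriv ^^ m) f z / fact m * y ^ m)) / y ^ n) (?D z) < e"
    if y: "y \<noteq> 0" "\<bar>y\<bar> < min \<epsilon> \<eta>" for y
  proof -
    have "((\<lambda>t. (deriv ^^ m) f (z + t)) has_real_derivative (deriv ^^ Suc m) f (z + t)) (at t)"
      if "m < n \<and> \<bar>t\<bar> \<le> \<bar>y\<bar>" for m t
    proof -
      have "((deriv ^^ m) f has_real_derivative deriv ((deriv ^^ m) f) (z + t)) (at (z + t))"
        using that y by (intro field_differentiable_derivI \<epsilon>(2)) (auto simp: dist_real_def)
      then show ?thesis
        by (simp add: DERIV_shift add.commute)
    qed
    then obtain t where t: "\<bar>t\<bar> \<le> \<bar>y\<bar>"
        "f (z + y) = (\<Sum>m<n. (deriv ^^ m) f z / fact m * y ^ m) + ?D (z + t) * y ^ n"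
      using Maclaurin_bi_le[of "\<lambda>m t. (deriv ^^ m) f (z + t)" "\<lambda>t. f (z + t)" n y] by auto
    then have "(f (z + y) - (\<Sum>m<n. (deriv ^^ m) f z / fact m * y ^ m)) / y ^ n = ?D (z + t)"
      using y by simp
    then show ?thesis
      using \<eta>(2)[of "z + t"] t(1) y by (simp add: dist_real_def)
  qed
  then show "\<forall>\<^sub>F y in at 0.
      dist ((f (z + y) - (\<Sum>m<n. (deriv ^^ m) f z / fact m * y ^ m)) / y ^ n) (?D z) < e"
    unfolding eventually_at using \<epsilon>(1) \<eta>(1)
    by (intro exI[of _ "min \<epsilon> \<eta>"]) (auto simp: dist_real_def)
qed

text \<open>Average the Taylor quotient \<open>Q\<close> over \<open>y\<close> and
  \<open>- y\<close>. The Taylor polynomial \<open>T\<close> is even by \<open>vanish\<close> and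
  cancels, since the odd power \<open>y ^ N\<close> changes sign; the same sign turns the sum into a
  difference of values of \<open>f\<close>.\<close>

lemma odd_part_tendsto:
  assumes "C_near N f z" "odd N"
    and vanish: "\<And>m. m < N \<Longrightarrow> odd m \<Longrightarrow> (deriv ^^ m) f z = 0"
  shows "((\<lambda>y. (f (z + y) - f (z - y)) / 2 / y ^ N) \<longlongrightarrow> (deriv ^^ N) f z / fact N) (at 0)"
proof -
  define T where "T = (\<lambda>y. \<Sum>m<N. (deriv ^^ m) f z / fact m * y ^ m)"
  define Q where "Q = (\<lambda>y. (f (z + y) - T y) / y ^ N)"
  have Q: "(Q \<longlongrightarrow> (deriv ^^ N) f z / fact N) (at 0)"
    unfolding Q_def T_def using assms(1) by (rule Taylor_remainder_tendsto)
  have "filterlim (\<lambda>y::real. - y) (at 0) (at 0)"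
    by (rule filterlim_atI) (auto intro!: tendsto_eq_intros simp: eventually_at_filter)
  with Q have "((\<lambda>y. Q (- y)) \<longlongrightarrow> (deriv ^^ N) f z / fact N) (at 0)"
    by (rule filterlim_compose)
  with Q have "((\<lambda>y. (Q y + Q (- y)) / 2) \<longlongrightarrow> ((deriv ^^ N) f z / fact N + (deriv ^^ N) f z / fact N) / 2) (at 0)"
    by (intro tendsto_intros) auto
  moreover have "(Q y + Q (- y)) / 2 = (f (z + y) - f (z - y)) / 2 / y ^ N" for y
  proof -
    have "T (- y) = T y"
      unfolding T_def
    proof (intro sum.cong refl)
      fix m assume "m \<in> {..<N}"
      then show "(deriv ^^ m) f z / fact m * (- y) ^ m = (deriv ^^ m) f z / fact m * y ^ m"
        using vanish[of m] by (cases "even m") auto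
    qed
    then show ?thesis
      using \<open>odd N\<close> by (simp add: Q_def diff_divide_distrib add_divide_distrib)
  qed
  ultimately show ?thesis
    by simp
qed

section \<open>Application to the symmetric and the generic case\<close>

lemma C_near_imp_continuous:
  assumes "C_near n f z"
  obtains \<delta> where "\<delta> > 0" "continuous_on (ball z \<delta>) f"
  using C_near_le[OF assms, of 0] by (auto simp: C_near_def)

text \<open>\<open>C_near\<close> makes explicit the smoothness behind the order of the critical
  point. In the symmetric case the last hypothesis ensures that the minimum in \<open>kappa\<close>
  exists and refers to a continuous derivative.\<close>

theorem theorem2p1:
  fixes f :: "real \<Rightarrow> real" and z \<alpha> :: real and r i k n :: nat and d :: data_kind
  assumes "r \<ge> 2" and "i \<le> r - 1"
    and "C_near n f z" and "k + 1 \<le> n"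
    and "critical_point_of_order f k z"
    and "r = 2 \<and> \<alpha> + real i = 1/2 \<Longrightarrow>
           \<exists>l. 2 dvd l \<and> l \<ge> k \<and> l + 1 \<le> n \<and> (deriv ^^ (l + 1)) f z \<noteq> 0"
  shows "exact_order (\<lambda>h. smoothness_indicator d z \<alpha> h r i f) (2 * real (kappa f z \<alpha> r i k))"
proof -
  obtain \<delta> where \<delta>: "\<delta> > 0" "continuous_on (ball z \<delta>) f"
    using C_near_imp_continuous[OF assms(3)] .
  have cont: "continuous_on (ball 0 \<delta>) (\<lambda>y. f (z + y))" "continuous_on (ball 0 \<delta>) (\<lambda>y. f (z - y))"
    by (rule continuous_on_compose2[OF \<delta>(2)]; force simp: dist_real_def intro!: continuous_intros)+
  have crit: "\<And>l. l \<in> {1..k} \<Longrightarrow> (deriv ^^ l) f z = 0" "(deriv ^^ (k + 1)) f z \<noteq> 0"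
    using assms(5) by (auto simp: critical_point_of_order_def)
  show ?thesis
  proof (cases "r = 2 \<and> \<alpha> + real i = 1/2")
    case True
    define l where "l = (LEAST l. 2 dvd l \<and> l \<ge> k \<and> (deriv ^^ (l + 1)) f z \<noteq> 0)"
    obtain l' where l': "2 dvd l'" "l' \<ge> k" "l' + 1 \<le> n" "(deriv ^^ (l' + 1)) f z \<noteq> 0"
      using assms(6)[OF True] by blast
    have l: "2 dvd l \<and> l \<ge> k \<and> (deriv ^^ (l + 1)) f z \<noteq> 0"
      unfolding l_def by (rule LeastI[of _ l']) (use l' in auto)
    \<comment> \<open>Minimality keeps the order \<open>l + 1\<close> within the available
      smoothness \<open>n\<close>.\<close>
    have "l \<le> l'"
      unfolding l_def by (rule Least_le) (use l' in auto)
    have C: "C_near (l + 1) f z"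
      using C_near_le[OF assms(3)] \<open>l \<le> l'\<close> l'(3) by simp
    \<comment> \<open>An odd \<open>m\<close> above \<open>k\<close> gives the even number
      \<open>m - 1\<close>, which is at least \<open>k\<close> and below \<open>l\<close>; a nonzero
      derivative of order \<open>m\<close> would contradict minimality of \<open>l\<close>.\<close>
    have vanish: "(deriv ^^ m) f z = 0" if "m < l + 1" "odd m" for m
    proof (cases "m \<le> k")
      case True
      with that show ?thesis
        by (intro crit(1)) (auto simp: odd_pos Suc_leI)
    next
      case False
      with that have "m - 1 < l" "2 dvd m - 1" "k \<le> m - 1" "m - 1 + 1 = m"
        using odd_pos[OF that(2)] l by auto
      then show ?thesis
        using not_less_Least[of "m - 1" "\<lambda>l. 2 dvd l \<and> l \<ge> k \<and> (deriv ^^ (l + 1)) f z \<noteq> 0"]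
        unfolding l_def[symmetric] by (metis (no_types, lifting))
    qed
    have "kappa f z \<alpha> r i k = l + 1"
      using True by (simp add: kappa_def l_def)
    \<comment> \<open>The stencil has only the indices \<open>int i - 1\<close> and
      \<open>int i\<close>, with centres \<open>- 1/2\<close> and \<open>1/2\<close>, so the even
      part has the same datum at both.\<close>
    moreover have "exact_order (\<lambda>h. smoothness_indicator d z \<alpha> h r i f) (2 * real (l + 1))"
    proof (rule exact_order_smoothness_indicator[where C = "(deriv ^^ (l + 1)) f z / fact (l + 1)"
          and e = "\<lambda>y. (f (z + y) + f (z - y)) / 2" and g = "\<lambda>y. (f (z + y) - f (z - y)) / 2"
          and A = "\<lambda>h. cell_mean d (1/2) (\<lambda>t. (f (z + t * h) + f (z - t * h)) / 2)"
          and j = "int i - 1" and \<delta> = \<delta>])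
      show "((\<lambda>y. (f (z + y) - f (z - y)) / 2 / y ^ (l + 1)) \<longlongrightarrow> (deriv ^^ (l + 1)) f z / fact (l + 1)) (at 0)"
        using C vanish l by (intro odd_part_tendsto) auto
      show "(deriv ^^ (l + 1)) f z / fact (l + 1) \<noteq> 0"
        unfolding divide_eq_0_iff using l fact_nonzero[of "l + 1", where ?'a = real] by blast
      fix j :: int and h :: real
      let ?e = "\<lambda>t. (f (z + t * h) + f (z - t * h)) / 2"
      assume "j \<in> {- int r + 1 + int i..int i}"
      then have "j = int i \<or> j = int i - 1"
        using True by auto
      then have "\<alpha> + of_int j = 1/2 \<or> \<alpha> + of_int j = - (1/2)"
        using True by auto
      moreover have "cell_mean d (- (1/2)) ?e = cell_mean d (1/2) ?e"
        unfolding cell_mean_reflect by (simp add: add.commute)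
      ultimately show "cell_mean d (\<alpha> + of_int j) ?e = cell_mean d (1/2) ?e"
        by (elim disjE) (simp_all only:)
    next
      show "cell_mean d (\<alpha> + of_int (int i - 1)) (\<lambda>t. t ^ (l + 1)) \<noteq>
          cell_mean d (\<alpha> + of_int (int i - 1) + 1) (\<lambda>t. t ^ (l + 1))"
      proof
        assume "cell_mean d (\<alpha> + of_int (int i - 1)) (\<lambda>t. t ^ (l + 1)) =
          cell_mean d (\<alpha> + of_int (int i - 1) + 1) (\<lambda>t. t ^ (l + 1))"
        \<comment> \<open>Equality would make \<open>l + 1\<close> even, but \<open>l\<close> is
          even.\<close>
        from cell_mean_power_adjacent_eq[OF _ this] show False
          using l by simp
      qed
    qed (use True \<delta>(1) l cont in \<open>auto simp: field_simps intro!: continuous_intros\<close>)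
    ultimately show ?thesis
      by simp
  next
    case False
    \<comment> \<open>For \<open>r = 2\<close> the only adjacent pair is not symmetric about 0 by
      the case assumption; for larger \<open>r\<close> there are at least two pairs, and at most one
      of them is symmetric.\<close>
    have "\<exists>j. j \<in> {- int r + 1 + int i..<int i} \<and> \<alpha> + of_int j \<noteq> - 1/2"
    proof (cases "r = 2")
      case True
      with False show ?thesis
        by (intro exI[of _ "int i - 1"]) auto
    next
      case False
      then show ?thesis
        using assms(1)
        by (intro exI[of _ "if \<alpha> + of_int (int i - 1) = - 1/2 then int i - 2 else int i - 1"]) auto
    qed
    then obtain j where j: "j \<in> {- int r + 1 + int i..<int i}" "\<alpha> + of_int j \<noteq> - 1/2"
      by blast
    have "kappa f z \<alpha> r i k = k + 1"
      unfolding kappa_def using False by (rule if_not_P)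
    moreover have "exact_order (\<lambda>h. smoothness_indicator d z \<alpha> h r i f) (2 * real (k + 1))"
    proof (rule exact_order_smoothness_indicator[where C = "(deriv ^^ (k + 1)) f z / fact (k + 1)"
          and e = "\<lambda>y. f z" and g = "\<lambda>y. f (z + y) - f z" and A = "\<lambda>h. f z" and j = j and \<delta> = \<delta>])
      \<comment> \<open>The terms of orders 1 to \<open>k\<close> vanish at the critical point, so
        \<open>f (z + y) - f z\<close> is the full Taylor remainder.\<close>
      have "(\<Sum>m<k + 1. (deriv ^^ m) f z / fact m * y ^ m) = f z" for y
      proof -
        have "(\<Sum>m<k + 1. (deriv ^^ m) f z / fact m * y ^ m) = (\<Sum>m<k + 1. if m = 0 then f z else 0)"
          by (intro sum.cong) (auto simp: crit(1) less_Suc_eq_le Suc_leI)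
        then show ?thesis
          by simp
      qed
      then show "((\<lambda>y. (f (z + y) - f z) / y ^ (k + 1)) \<longlongrightarrow> (deriv ^^ (k + 1)) f z / fact (k + 1)) (at 0)"
        using Taylor_remainder_tendsto[OF C_near_le[OF assms(3,4)]] by simp
      show "(deriv ^^ (k + 1)) f z / fact (k + 1) \<noteq> 0"
        unfolding divide_eq_0_iff using crit(2) fact_nonzero[of "k + 1", where ?'a = real] by blast
      show "cell_mean d (\<alpha> + of_int j) (\<lambda>t. t ^ (k + 1)) \<noteq> cell_mean d (\<alpha> + of_int j + 1) (\<lambda>t. t ^ (k + 1))"
        using cell_mean_power_adjacent_eq[of "k + 1" d "\<alpha> + of_int j"] j(2) by auto
    qed (use assms(1) \<delta>(1) j(1) crit(2) cont in \<open>auto intro!: continuous_intros\<close>)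
    ultimately show ?thesis
      by simp
  qed
qed

end
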